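(* A topological dynamical system $(X,T)$ is mean equicontinuous if and only if it is Weyl mean equicontinuous.
   Context: A topological dynamical system is a pair $(X,T)$ where $X$ is a non-empty compact metric space with metric $d$ and $T\colon X\to X$ is a continuous map. $(X,T)$ is mean equicontinuous if for every $\varepsilon>0$ there exists $\delta>0$ such that whenever $x,y\in X$ with $d(x,y)<\delta$, we have $\limsup_{n\to\infty}\frac1n\sum_{i=0}^{n-1}d(T^ix,T^iy)<\varepsilon$. $(X,T)$ is Weyl mean equicontinuous (also called Banach mean equicontinuous) if for every $\varepsilon>0$ there exists $\delta>0$ such that $$\limsup_{n-m\to\infty}\frac{1}{n-m}\sum_{i=m}^{n-1}d(T^ix,T^iy)<\varepsilon$$ for all $x,y\in X$ with $d(x,y)<\delta$, where $m,n$ range over non-negative integers with $m<n$. *)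

theory Defs
  imports "HOL-Analysis.Analysis"
begin

text \<open>The space is a set \<open>X\<close> in an arbitrary metric space type and carries the restricted metric; \<open>T\<close>
  is only relevant on \<open>X\<close>.\<close>

definition topological_dynamical_system :: "'a::metric_space set \<Rightarrow> ('a \<Rightarrow> 'a) \<Rightarrow> bool" where
  "topological_dynamical_system X T \<longleftrightarrow>
     X \<noteq> {} \<and> compact X \<and> continuous_on X T \<and> T ` X \<subseteq> X"

text \<open>Upper limits are taken in the complete lattice \<^typ>\<open>ereal\<close>.\<close>

definition mean_equicontinuous :: "'a::metric_space set \<Rightarrow> ('a \<Rightarrow> 'a) \<Rightarrow> bool" where
  "mean_equicontinuous X T \<longleftrightarrow>
     (\<forall>\<epsilon>>0. \<exists>\<delta>>0. \<forall>x\<in>X. \<forall>y\<in>X. dist x y < \<delta> \<longrightarrow>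
        limsup (\<lambda>n. ereal (1 / real n * (\<Sum>i = 0..<n. dist ((T ^^ i) x) ((T ^^ i) y)))) < ereal \<epsilon>)"

text \<open>The filter for \<open>n - m \<rightarrow> \<infinity>\<close> on pairs \<open>(m, n)\<close> of natural numbers: a property holds eventually iff,
  for some \<open>K\<close>, it holds for all pairs with \<open>n - m \<ge> K\<close>. Subtraction on \<^typ>\<open>nat\<close> is truncated, but
  for \<open>K \<ge> 1\<close> the condition \<open>n - m \<ge> K\<close> forces \<open>m < n\<close>, so pairs with \<open>m \<ge> n\<close> play no role.\<close>

definition diff_at_top :: "(nat \<times> nat) filter" where
  "diff_at_top = filtercomap (\<lambda>(m, n). n - m) at_top"

definition Weyl_mean_equicontinuous :: "'a::metric_space set \<Rightarrow> ('a \<Rightarrow> 'a) \<Rightarrow> bool" where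
  "Weyl_mean_equicontinuous X T \<longleftrightarrow>
     (\<forall>\<epsilon>>0. \<exists>\<delta>>0. \<forall>x\<in>X. \<forall>y\<in>X. dist x y < \<delta> \<longrightarrow>
        Limsup diff_at_top
          (\<lambda>(m, n). ereal (1 / real (n - m) * (\<Sum>i = m..<n. dist ((T ^^ i) x) ((T ^^ i) y)))) < ereal \<epsilon>)"

end

theory Submission
  imports Defs
begin

text \<open>For the hard direction fix \<open>x, y\<close> and put \<open>a i = d (T\<^sup>i x, T\<^sup>i y)\<close>. If \<open>a\<close> has arbitrarily long blocks
  of average larger than \<open>c\<close>, then for every \<open>N\<close> some position \<open>m\<close> has the property that all averages
  of length at most \<open>N\<close> starting at \<open>m\<close> are at least \<open>c\<close>: otherwise a long block could be cut into
  pieces of length at most \<open>N\<close> and average below \<open>c\<close>. A limit point \<open>(p, q)\<close> of the corresponding pairs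
  \<open>(T\<^sup>m x, T\<^sup>m y)\<close> has all its averages at least \<open>c\<close>. But the upper mean distance is invariant along
  orbits and, by mean equicontinuity, continuous, so its value at \<open>(p, q)\<close> is its value at \<open>(x, y)\<close>.\<close>

text \<open>Blocks of average below \<open>c\<close> are peeled off the front by strong induction on
  \<open>l\<close>. Only the final piece of length at most \<open>N\<close> escapes this bound, and
  it costs at most \<open>N * B\<close>. This error does not depend on \<open>l\<close>, so it
  vanishes in averages over long blocks.\<close>

lemma block_sum_le:
  fixes a :: "nat \<Rightarrow> real"
  assumes short: "\<And>m. \<exists>k\<in>{1..N}. (\<Sum>i<k. a (m + i)) < c * real k"
    and bnd: "\<And>i. a i \<le> B" and "0 \<le> B" "0 \<le> c"
  shows "(\<Sum>i<l. a (m + i)) \<le> c * real l + real N * B"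
proof (induction l arbitrary: m rule: less_induct)
  case (less l)
  show ?case
  proof (cases "l \<le> N")
    case True
    have "(\<Sum>i<l. a (m + i)) \<le> real l * B"
      using sum_bounded_above[of "{..<l}" "\<lambda>i. a (m + i)" B] bnd by simp
    also have "\<dots> \<le> real N * B" using True \<open>0 \<le> B\<close> by (simp add: mult_right_mono)
    also have "\<dots> \<le> c * real l + real N * B" using \<open>0 \<le> c\<close> by simp
    finally show ?thesis .
  next
    case False
    obtain k where k: "1 \<le> k" "k \<le> N" "(\<Sum>i<k. a (m + i)) < c * real k"
      using short[of m] by auto
    \<comment> \<open>\<open>k \<ge> 1\<close> makes the remainder strictly shorter, and
      \<open>k \<le> N < l\<close> makes it a genuine split.\<close>
    obtain j where j: "l = k + j" "j < l"
      using k False by (metis le_add_diff_inverse nat_le_linear less_add_same_cancel2 less_le_trans zero_less_one le_trans)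
    have "(\<Sum>i<l. a (m + i)) = (\<Sum>i<k. a (m + i)) + (\<Sum>i<j. a (m + k + i))"
      unfolding j(1) by (induction j) (auto simp: add.assoc)
    also have "\<dots> \<le> c * real k + (c * real j + real N * B)"
      using k(3) less.IH[OF j(2), of "m + k"] by (intro add_mono) auto
    also have "\<dots> = c * real l + real N * B" by (simp add: j(1) algebra_simps)
    finally show ?thesis .
  qed
qed

lemma limsup_average_lessD:
  fixes f :: "nat \<Rightarrow> real"
  assumes "limsup (\<lambda>n. ereal (1 / real n * (\<Sum>i = 0..<n. f i))) < ereal e"
  obtains c where "c < e" "\<forall>\<^sub>F n in sequentially. (\<Sum>i<n. f i) \<le> c * real n"
proof -
  obtain b where b: "limsup (\<lambda>n. ereal (1 / real n * (\<Sum>i = 0..<n. f i))) < ereal b" "b < e"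
    using ereal_dense2[OF assms] by auto
  have "\<forall>\<^sub>F n in sequentially. ereal (1 / real n * (\<Sum>i = 0..<n. f i)) < ereal b"
    using Limsup_lessD[OF b(1)] .
  then have "\<forall>\<^sub>F n in sequentially. (\<Sum>i<n. f i) \<le> b * real n"
    using eventually_gt_at_top[of 0]
    by eventually_elim (simp add: field_simps atLeast0LessThan)
  with b(2) that show thesis by blast
qed

text \<open>By nonnegativity the shifted sum is at most the sum of the first \<open>n + m\<close>
  terms. The extra \<open>c * m\<close> is absorbed by the gap \<open>(c' - c) * n\<close> for large
  \<open>n\<close>. This is the half of the orbit invariance of the upper mean that the main
  argument uses.\<close>

lemma eventually_shifted_sum_le:
  fixes a :: "nat \<Rightarrow> real"
  assumes nonneg: "\<And>i. 0 \<le> a i"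
    and ev: "\<forall>\<^sub>F n in sequentially. (\<Sum>i<n. a i) \<le> c * real n" and "c < c'"
  shows "\<forall>\<^sub>F n in sequentially. (\<Sum>i<n. a (m + i)) \<le> c' * real n"
proof -
  have "\<forall>\<^sub>F n in sequentially. (\<Sum>i<n + m. a i) \<le> c * real (n + m)"
    using ev by (rule sequentially_offset)
  \<comment> \<open>This threshold is equivalent to \<open>c * (n + m) \<le> c' * n\<close>.\<close>
  moreover have "\<forall>\<^sub>F n in sequentially. c * real m / (c' - c) \<le> real n"
    using filterlim_real_sequentially by (simp add: filterlim_at_top)
  ultimately show ?thesis
  proof eventually_elim
    case (elim n)
    have "(\<Sum>i<n + m. a i) = (\<Sum>i<m. a i) + (\<Sum>i<n. a (m + i))"
      by (induction n) (auto simp: add.commute)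
    then have "(\<Sum>i<n. a (m + i)) \<le> (\<Sum>i<n + m. a i)"
      by (simp add: sum_nonneg nonneg)
    also have "\<dots> \<le> c' * real n"
      using elim \<open>c < c'\<close> by (simp add: field_simps)
    finally show ?case .
  qed
qed

lemma tendsto_funpow_on:
  assumes "continuous_on X T" "T ` X \<subseteq> X" "\<And>j. f j \<in> X" "p \<in> X" "f \<longlonglongrightarrow> p"
  shows "(\<lambda>j. (T ^^ i) (f j)) \<longlonglongrightarrow> (T ^^ i) p"
proof -
  have "(T ^^ i) z \<in> X" if "z \<in> X" for i z
    using that assms(2) by (induction i) auto
  then show ?thesis
    using assms by (induction i) (auto intro!: continuous_on_tendsto_compose[OF assms(1)])
qed

lemma mean_equicontinuousD:
  assumes "mean_equicontinuous X T" "0 < e"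
  obtains \<delta> where "0 < \<delta>"
    "\<And>x y. \<lbrakk>x \<in> X; y \<in> X; dist x y < \<delta>\<rbrakk> \<Longrightarrow>
      \<exists>c<e. \<forall>\<^sub>F n in sequentially. (\<Sum>i<n. dist ((T ^^ i) x) ((T ^^ i) y)) \<le> c * real n"
proof -
  obtain \<delta> where "0 < \<delta>" and \<delta>: "\<forall>x\<in>X. \<forall>y\<in>X. dist x y < \<delta> \<longrightarrow>
      limsup (\<lambda>n. ereal (1 / real n * (\<Sum>i = 0..<n. dist ((T ^^ i) x) ((T ^^ i) y)))) < ereal e"
    using assms unfolding mean_equicontinuous_def by blast
  show thesis
  proof (rule that[OF \<open>0 < \<delta>\<close>])
    fix x y assume "x \<in> X" "y \<in> X" "dist x y < \<delta>"
    with \<delta> show "\<exists>c<e. \<forall>\<^sub>F n in sequentially. (\<Sum>i<n. dist ((T ^^ i) x) ((T ^^ i) y)) \<le> c * real n"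
      by (blast elim: limsup_average_lessD)
  qed
qed

text \<open>Compactness makes \<open>N\<close> uniform in \<open>m\<close>. The gap between
  \<open>c\<close> and \<open>c'\<close> pays for shifting along the orbit and for replacing the
  limit pair by a nearby orbit pair, so estimates with small errors stand in for equality of upper
  mean distances.\<close>

lemma mean_equicontinuous_short_blocks:
  fixes X :: "'a::metric_space set"
  assumes tds: "topological_dynamical_system X T" and me: "mean_equicontinuous X T"
    and "x \<in> X" "y \<in> X" "c < c'"
    and ev: "\<forall>\<^sub>F n in sequentially. (\<Sum>i<n. dist ((T ^^ i) x) ((T ^^ i) y)) \<le> c * real n"
  shows "\<exists>N. \<forall>m. \<exists>k\<in>{1..N}. (\<Sum>i<k. dist ((T ^^ (m + i)) x) ((T ^^ (m + i)) y)) < c' * real k"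
proof (rule ccontr)
  assume "\<not> ?thesis"
  then have "\<forall>N. \<exists>m. \<forall>k\<in>{1..N}.
      c' * real k \<le> (\<Sum>i<k. dist ((T ^^ (m + i)) x) ((T ^^ (m + i)) y))"
    by (simp add: not_less)
  then obtain M where M: "\<And>N k. k \<in> {1..N} \<Longrightarrow>
      c' * real k \<le> (\<Sum>i<k. dist ((T ^^ (M N + i)) x) ((T ^^ (M N + i)) y))"
    by metis
  have "compact X" and cont: "continuous_on X T" and TX: "T ` X \<subseteq> X"
    using tds by (auto simp: topological_dynamical_system_def)
  have inX: "(T ^^ i) z \<in> X" if "z \<in> X" for i z
    using that TX by (induction i) auto
  have "\<forall>N. ((T ^^ M N) x, (T ^^ M N) y) \<in> X \<times> X"
    using inX \<open>x \<in> X\<close> \<open>y \<in> X\<close> by simp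
  with compact_Times[OF \<open>compact X\<close> \<open>compact X\<close>] obtain l r where "l \<in> X \<times> X" "strict_mono r"
    and lim: "((\<lambda>N. ((T ^^ M N) x, (T ^^ M N) y)) \<circ> r) \<longlonglongrightarrow> l"
    by (rule compact_imp_seq_compact[THEN seq_compactE])
  obtain p q where [simp]: "l = (p, q)" by force
  have "p \<in> X" "q \<in> X" using \<open>l \<in> X \<times> X\<close> by auto
  have limp: "(\<lambda>j. (T ^^ M (r j)) x) \<longlonglongrightarrow> p" and limq: "(\<lambda>j. (T ^^ M (r j)) y) \<longlonglongrightarrow> q"
    using tendsto_fst[OF lim] tendsto_snd[OF lim] by (auto simp: o_def)
  have shift: "(T ^^ (m + i)) z = (T ^^ i) ((T ^^ m) z)" for m i z
    by (simp add: add.commute funpow_add)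
  \<comment> \<open>For fixed \<open>k\<close> the sum is continuous in the pair of points, and the
    bound from \<open>M\<close> applies as soon as \<open>k \<le> r j\<close>, which holds for
    \<open>j \<ge> k\<close>.\<close>
  have lower: "c' * real k \<le> (\<Sum>i<k. dist ((T ^^ i) p) ((T ^^ i) q))" if "1 \<le> k" for k
  proof (rule LIMSEQ_le_const)
    show "(\<lambda>j. \<Sum>i<k. dist ((T ^^ i) ((T ^^ M (r j)) x)) ((T ^^ i) ((T ^^ M (r j)) y)))
        \<longlonglongrightarrow> (\<Sum>i<k. dist ((T ^^ i) p) ((T ^^ i) q))"
      by (intro tendsto_sum tendsto_dist tendsto_funpow_on[OF cont TX] inX limp limq
          \<open>x \<in> X\<close> \<open>y \<in> X\<close> \<open>p \<in> X\<close> \<open>q \<in> X\<close>)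
    show "\<exists>J. \<forall>j\<ge>J. c' * real k
        \<le> (\<Sum>i<k. dist ((T ^^ i) ((T ^^ M (r j)) x)) ((T ^^ i) ((T ^^ M (r j)) y)))"
    proof (intro exI allI impI)
      fix j assume "k \<le> j"
      then have "k \<in> {1..r j}"
        using that seq_suble[OF \<open>strict_mono r\<close>, of j] by simp
      from M[OF this] show "c' * real k
          \<le> (\<Sum>i<k. dist ((T ^^ i) ((T ^^ M (r j)) x)) ((T ^^ i) ((T ^^ M (r j)) y)))"
        by (simp add: shift)
    qed
  qed
  \<comment> \<open>Three errors below or equal to \<open>h\<close> occur: one for the shift by
    \<open>m\<close> and one for each of \<open>p\<close> and \<open>q\<close>. Their total keeps
    the average below \<open>c + 3 * h < c'\<close>.\<close>
  define h where "h = (c' - c) / 4"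
  have "0 < h" using \<open>c < c'\<close> by (simp add: h_def)
  obtain \<delta> where "0 < \<delta>" and \<delta>: "\<And>x y. \<lbrakk>x \<in> X; y \<in> X; dist x y < \<delta>\<rbrakk> \<Longrightarrow>
      \<exists>c<h. \<forall>\<^sub>F n in sequentially. (\<Sum>i<n. dist ((T ^^ i) x) ((T ^^ i) y)) \<le> c * real n"
    using mean_equicontinuousD[OF me \<open>0 < h\<close>] by blast
  have "\<forall>\<^sub>F j in sequentially. dist ((T ^^ M (r j)) x) p < \<delta> \<and> dist ((T ^^ M (r j)) y) q < \<delta>"
    using tendstoD[OF limp \<open>0 < \<delta>\<close>] tendstoD[OF limq \<open>0 < \<delta>\<close>] by (rule eventually_conj)
  then obtain m where m: "dist ((T ^^ m) x) p < \<delta>" "dist ((T ^^ m) y) q < \<delta>"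
    using eventually_happens'[OF sequentially_bot] by blast
  obtain e1 where "e1 < h" and e1: "\<forall>\<^sub>F n in sequentially.
      (\<Sum>i<n. dist ((T ^^ i) ((T ^^ m) x)) ((T ^^ i) p)) \<le> e1 * real n"
    using \<delta>[OF inX[OF \<open>x \<in> X\<close>] \<open>p \<in> X\<close> m(1)] by blast
  obtain e2 where "e2 < h" and e2: "\<forall>\<^sub>F n in sequentially.
      (\<Sum>i<n. dist ((T ^^ i) ((T ^^ m) y)) ((T ^^ i) q)) \<le> e2 * real n"
    using \<delta>[OF inX[OF \<open>y \<in> X\<close>] \<open>q \<in> X\<close> m(2)] by blast
  have "\<forall>\<^sub>F n in sequentially.
      (\<Sum>i<n. dist ((T ^^ (m + i)) x) ((T ^^ (m + i)) y)) \<le> (c + h) * real n"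
    using eventually_shifted_sum_le[OF _ ev, of "c + h" m] \<open>0 < h\<close> by simp
  \<comment> \<open>The triangle inequality through the orbits of \<open>(T ^^ m) x\<close> and
    \<open>(T ^^ m) y\<close> contradicts \<open>lower\<close>; \<open>n > 0\<close> makes the final
    inequality strict.\<close>
  then have "\<forall>\<^sub>F n in sequentially. False"
    using e1 e2 eventually_gt_at_top[of 0]
  proof eventually_elim
    case (elim n)
    have "(\<Sum>i<n. dist ((T ^^ i) p) ((T ^^ i) q)) \<le>
        (\<Sum>i<n. dist ((T ^^ i) ((T ^^ m) x)) ((T ^^ i) p)
          + dist ((T ^^ (m + i)) x) ((T ^^ (m + i)) y)
          + dist ((T ^^ i) ((T ^^ m) y)) ((T ^^ i) q))"
      unfolding shift
    proof (rule sum_mono)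
      fix i
      let ?p = "(T ^^ i) p" and ?q = "(T ^^ i) q"
        and ?x = "(T ^^ i) ((T ^^ m) x)" and ?y = "(T ^^ i) ((T ^^ m) y)"
      show "dist ?p ?q \<le> dist ?x ?p + dist ?x ?y + dist ?y ?q"
        using dist_triangle[of ?p ?q ?x] dist_triangle[of ?x ?q ?y] dist_commute[of ?p ?x]
        by linarith
    qed
    also have "\<dots> \<le> e1 * real n + (c + h) * real n + e2 * real n"
      unfolding sum.distrib using elim by (intro add_mono) auto
    also have "\<dots> = (e1 + (c + h) + e2) * real n" by (simp add: algebra_simps)
    also have "\<dots> < c' * real n"
    proof (rule mult_strict_right_mono)
      show "e1 + (c + h) + e2 < c'"
        using \<open>e1 < h\<close> \<open>e2 < h\<close> \<open>0 < h\<close> unfolding h_def by argo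
    qed (use elim in simp)
    finally show False using lower[of n] elim by simp
  qed
  then show False by simp
qed

lemma eventually_diff_at_top:
  "eventually P diff_at_top \<longleftrightarrow> (\<exists>K. \<forall>m n. K \<le> n - m \<longrightarrow> P (m, n))"
proof
  assume "eventually P diff_at_top"
  then show "\<exists>K. \<forall>m n. K \<le> n - m \<longrightarrow> P (m, n)"
    unfolding diff_at_top_def eventually_filtercomap eventually_at_top_linorder by fastforce
next
  assume "\<exists>K. \<forall>m n. K \<le> n - m \<longrightarrow> P (m, n)"
  then obtain K where "\<forall>m n. K \<le> n - m \<longrightarrow> P (m, n)" ..
  then show "eventually P diff_at_top"
    unfolding diff_at_top_def eventually_filtercomap
    by (intro exI[of _ "\<lambda>l. K \<le> l"]) (auto intro: eventually_ge_at_top)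
qed

lemma Weyl_imp_mean_equicontinuous:
  assumes "Weyl_mean_equicontinuous X T"
  shows "mean_equicontinuous X T"
  unfolding mean_equicontinuous_def
proof (intro allI impI)
  fix e :: real assume "0 < e"
  let ?W = "\<lambda>x y (m, n). ereal (1 / real (n - m) * (\<Sum>i = m..<n. dist ((T ^^ i) x) ((T ^^ i) y)))"
  let ?A = "\<lambda>x y n. ereal (1 / real n * (\<Sum>i = 0..<n. dist ((T ^^ i) x) ((T ^^ i) y)))"
  \<comment> \<open>Ordinary averages are the block averages along the pairs \<open>(0, n)\<close>.
    This path tends to \<open>diff_at_top\<close>, so its upper limit is at most the Weyl
    one.\<close>
  have initial: "filterlim (\<lambda>n. (0, n)) diff_at_top sequentially"
    unfolding diff_at_top_def filterlim_filtercomap_iff by (simp add: o_def filterlim_ident)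
  have le: "limsup (?A x y) \<le> Limsup diff_at_top (?W x y)" for x y
    unfolding Limsup_le_iff
  proof (intro allI impI)
    fix b assume "Limsup diff_at_top (?W x y) < b"
    then have "\<forall>\<^sub>F p in diff_at_top. ?W x y p < b" by (rule Limsup_lessD)
    from eventually_compose_filterlim[OF this initial]
    show "\<forall>\<^sub>F n in sequentially. ?A x y n < b" by simp
  qed
  obtain \<delta> where "0 < \<delta>" "\<forall>x\<in>X. \<forall>y\<in>X. dist x y < \<delta> \<longrightarrow> Limsup diff_at_top (?W x y) < ereal e"
    using assms \<open>0 < e\<close> unfolding Weyl_mean_equicontinuous_def by blast
  then show "\<exists>\<delta>>0. \<forall>x\<in>X. \<forall>y\<in>X. dist x y < \<delta> \<longrightarrow> limsup (?A x y) < ereal e"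
    using le_less_trans[OF le] by blast
qed

lemma mean_imp_Weyl_equicontinuous:
  fixes X :: "'a::metric_space set"
  assumes tds: "topological_dynamical_system X T" and me: "mean_equicontinuous X T"
  shows "Weyl_mean_equicontinuous X T"
  unfolding Weyl_mean_equicontinuous_def
proof (intro allI impI)
  fix e :: real assume "0 < e"
  let ?W = "\<lambda>x y (m, n). ereal (1 / real (n - m) * (\<Sum>i = m..<n. dist ((T ^^ i) x) ((T ^^ i) y)))"
  have TX: "T ` X \<subseteq> X" and "bounded X"
    using tds by (auto simp: topological_dynamical_system_def compact_imp_bounded)
  have inX: "(T ^^ i) z \<in> X" if "z \<in> X" for i z
    using that TX by (induction i) auto
  have diam: "dist ((T ^^ i) x) ((T ^^ i) y) \<le> diameter X" if "x \<in> X" "y \<in> X" for x y i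
    using \<open>bounded X\<close> inX that by (blast intro: diameter_bounded_bound)
  obtain \<delta> where "0 < \<delta>" and \<delta>: "\<And>x y. \<lbrakk>x \<in> X; y \<in> X; dist x y < \<delta>\<rbrakk> \<Longrightarrow>
      \<exists>c<e. \<forall>\<^sub>F n in sequentially. (\<Sum>i<n. dist ((T ^^ i) x) ((T ^^ i) y)) \<le> c * real n"
    using mean_equicontinuousD[OF me \<open>0 < e\<close>] by blast
  have "Limsup diff_at_top (?W x y) < ereal e" if xy: "x \<in> X" "y \<in> X" "dist x y < \<delta>" for x y
  proof -
    let ?a = "\<lambda>i. dist ((T ^^ i) x) ((T ^^ i) y)"
    obtain b where "b < e" and b: "\<forall>\<^sub>F n in sequentially. (\<Sum>i<n. ?a i) \<le> b * real n"
      using \<delta>[OF xy] by blast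
    \<comment> \<open>The midpoint gives the strict gap \<open>b < c\<close> required for short
      blocks, and the maximum secures \<open>0 \<le> c\<close> for \<open>block_sum_le\<close>. The
      second midpoint \<open>c'\<close> leaves room for the boundary error while staying below
      \<open>e\<close>.\<close>
    define c where "c = max 0 ((b + e) / 2)"
    define c' where "c' = (c + e) / 2"
    have c: "b < c" "0 \<le> c" "c < c'" "c' < e"
      using \<open>b < e\<close> \<open>0 < e\<close> by (auto simp: c_def c'_def max_def field_simps)
    obtain N where N: "\<And>m. \<exists>k\<in>{1..N}. (\<Sum>i<k. ?a (m + i)) < c * real k"
      using mean_equicontinuous_short_blocks[OF tds me xy(1,2) c(1) b] by blast
    let ?D = "real N * diameter X"
    \<comment> \<open>From length \<open>K\<close> on, the boundary error \<open>?D\<close> is at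
      most \<open>(c' - c)\<close> times the block length, uniformly in the starting point.\<close>
    obtain K where K: "?D / (c' - c) \<le> real K" using real_arch_simple by blast
    \<comment> \<open>\<open>Suc K\<close> instead of \<open>K\<close> forces \<open>m < n\<close>,
      so truncated subtraction is exact and the division is by a positive length.\<close>
    have avg: "?W x y (m, n) \<le> ereal c'" if "Suc K \<le> n - m" for m n
    proof -
      obtain l where l: "n = m + l" "Suc K \<le> l"
        using \<open>Suc K \<le> n - m\<close> by (intro that[of "n - m"]) auto
      have "(\<Sum>i = m..<n. ?a i) = (\<Sum>i<l. ?a (m + i))"
        unfolding l(1) by (induction l) auto
      also have "\<dots> \<le> c * real l + ?D"
        using diam[OF xy(1,2)] diameter_ge_0[OF \<open>bounded X\<close>] c(2)
        by (intro block_sum_le[OF N])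
      also have "?D \<le> (c' - c) * real K" using K c(3) by (simp add: field_simps)
      also have "\<dots> \<le> (c' - c) * real l" using l(2) c(3) by (intro mult_left_mono) auto
      finally have "(\<Sum>i = m..<n. ?a i) \<le> c' * real l" by (simp add: algebra_simps)
      then show ?thesis using l by (simp add: field_simps)
    qed
    have "Limsup diff_at_top (?W x y) \<le> ereal c'"
      using avg by (intro Limsup_bounded) (unfold eventually_diff_at_top, blast)
    also have "\<dots> < ereal e" using c by simp
    finally show ?thesis .
  qed
  with \<open>0 < \<delta>\<close> show "\<exists>\<delta>>0. \<forall>x\<in>X. \<forall>y\<in>X. dist x y < \<delta> \<longrightarrow> Limsup diff_at_top (?W x y) < ereal e"
    by blast
qed

theorem theorem5p1:
  fixes X :: "'a::metric_space set" and T :: "'a \<Rightarrow> 'a"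
  assumes "topological_dynamical_system X T"
  shows "mean_equicontinuous X T \<longleftrightarrow> Weyl_mean_equicontinuous X T"
  using assms mean_imp_Weyl_equicontinuous Weyl_imp_mean_equicontinuous by blast

end
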